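(* Let $G=(V,E)$ be a weighted undirected graph. For all $t\in\mathbb N$ and all $\eta,\delta\in(0,1]$, let $G^t$ be the graph of the $t$-step lazy random walk on $G$. Then $$\min\left(1-\left(1-\frac{\phi_G^2\!\left(\frac{4\delta}{\eta}\right)}{32}\right)^{t},\ 1-\eta\right)\ \le\ \phi_{G^t}(\delta)\ \le\ \frac{t}{2}\,\phi_G(\delta).$$
   Context: $G$ has nonnegative edge weights $w(i,j)$ and adjacency matrix $A$ with $A_{ij}=w(i,j)$. The degree of vertex $i$ is $d(i)=\sum_j w(i,j)$, and $D$ is the diagonal matrix with $D_{ii}=d(i)$. Degrees are positive, and the total volume $\sum_i d(i)$ is normalized to $1$. The volume of $S\subseteq V$ is $\vol(S)=\sum_{i\in S}d(i)$. For a weighted graph $H$ and a nonempty set $S$, the expansion is $\phi_H(S)=E_H(S,\bar S)/\vol_H(S)$, where $E_H(S,\bar S)$ is the total weight of edges crossing between $S$ and its complement. The expansion profile is $\phi_H(\delta)=\min_{S\subseteq V,\ \vol_H(S)\le\delta}\phi_H(S)$. The lazy random walk matrix is $M=\tfrac12(I+D^{-1}A)$. $G^t$ is the weighted graph on vertex set $V$ whose adjacency matrix is $DM^t$. This matrix is symmetric and may include self-loops, and the vertex degrees in $G^t$ are the same as in $G$. *)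

theory Defs
  imports "HOL-Analysis.Analysis"
begin

text \<open>
  A weighted graph is represented by its adjacency matrix; the vertex set is the finite index
  type. Self-loops (nonzero diagonal entries) are allowed, and a self-loop at \<open>i\<close> contributes
  its weight once to the degree of \<open>i\<close>.
\<close>

definition weighted_graph :: "real^'n^'n \<Rightarrow> bool" where
  "weighted_graph A \<longleftrightarrow> transpose A = A \<and> (\<forall>i j. 0 \<le> A $ i $ j)"

definition vertex_degree :: "real^'n^'n \<Rightarrow> 'n::finite \<Rightarrow> real" where
  "vertex_degree A i = (\<Sum>j\<in>UNIV. A $ i $ j)"

definition vol :: "real^'n^'n \<Rightarrow> 'n::finite set \<Rightarrow> real" where
  "vol A S = (\<Sum>i\<in>S. vertex_degree A i)"

definition cut_weight :: "real^'n^'n \<Rightarrow> 'n::finite set \<Rightarrow> real" where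
  "cut_weight A S = (\<Sum>i\<in>S. \<Sum>j\<in>-S. A $ i $ j)"

definition expansion :: "real^'n^'n \<Rightarrow> 'n::finite set \<Rightarrow> real" where
  "expansion A S = cut_weight A S / vol A S"

text \<open>
  The expansion profile is a minimum over nonempty vertex sets, as the expansion is defined only
  for those. The whole vertex set is an admissible competitor. If no nonempty set has volume at
  most \<open>\<delta>\<close>, the minimum is over the empty family and the value is meaningless.
\<close>

definition expansion_profile :: "real^'n^'n \<Rightarrow> real \<Rightarrow> real" where
  "expansion_profile A \<delta> =
     Min (expansion A ` {S :: 'n::finite set. S \<noteq> {} \<and> vol A S \<le> \<delta>})"

definition degree_matrix :: "real^'n^'n \<Rightarrow> real^'n^'n::finite" where
  "degree_matrix A = (\<chi> i j. if i = j then vertex_degree A i else 0)"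

definition lazy_walk :: "real^'n^'n \<Rightarrow> real^'n^'n::finite" where
  "lazy_walk A = (1 / 2) *\<^sub>R (mat 1 + matrix_inv (degree_matrix A) ** A)"

primrec matrix_power :: "real^'n^'n \<Rightarrow> nat \<Rightarrow> real^'n^'n::finite" where
  "matrix_power M 0 = mat 1"
| "matrix_power M (Suc t) = M ** matrix_power M t"

definition walk_graph :: "real^'n^'n \<Rightarrow> nat \<Rightarrow> real^'n^'n::finite" where
  "walk_graph A t = degree_matrix A ** matrix_power (lazy_walk A) t"

end

theory Submission
  imports Defs
begin

text \<open>
  In the inner product weighted by the degrees, the lazy walk matrix \<open>M\<close> is self-adjoint and
  satisfies \<open>M\<^sup>2 \<le> M \<le> I\<close>. For a set \<open>S\<close> put \<open>a t = \<langle>\<chi>\<^sub>S, M\<^sup>t \<chi>\<^sub>S\<rangle> / vol S\<close>, so that the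
  expansion of \<open>S\<close> in the graph of the \<open>t\<close>-step walk is \<open>1 - a t\<close>. The sequence \<open>a\<close> is convex,
  hence \<open>1 - a t \<le> t (1 - a 1)\<close>, which is the upper bound. It is also decreasing. As long as
  \<open>a (2 s) > \<eta>\<close>, the nonnegative vector \<open>f = M\<^sup>s \<chi>\<^sub>S\<close> has small \<open>1\<close>-norm relative to its \<open>2\<close>-norm,
  so subtracting a constant and taking positive parts yields a vector that keeps half of the
  squared norm and is supported on volume at most \<open>4 \<delta> / \<eta>\<close>. Cheeger's inequality on that
  support gives \<open>a (2 s + 1) \<le> (1 - \<phi>\<^sup>2 / 8) a (2 s)\<close>, and
  \<open>1 - \<phi>\<^sup>2 / 8 \<le> (1 - \<phi>\<^sup>2 / 32)\<^sup>2\<close> pays for the odd step, where only monotonicity is used.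
\<close>

lemma sum_eq_sum_indicator:
  fixes f :: "'a::finite \<Rightarrow> real"
  shows "sum f S = (\<Sum>i\<in>UNIV. f i * indicator S i)"
  by (rule sum.mono_neutral_cong_left) (auto simp: indicator_def)

section \<open>Degree-weighted inner product and Dirichlet energy\<close>

locale positive_weighted_graph =
  fixes A :: "real^'n^'n::finite"
  assumes graph: "weighted_graph A"
    and degree_pos: "\<And>i. 0 < vertex_degree A i"
begin

definition ip :: "real^'n \<Rightarrow> real^'n \<Rightarrow> real" where
  "ip f g = (\<Sum>i\<in>UNIV. vertex_degree A i * (f $ i * g $ i))"

text \<open>The Dirichlet form. The double sum meets every edge between distinct vertices in both
  directions, hence the division by 2; self-loops contribute nothing.\<close>

definition energy :: "real^'n \<Rightarrow> real" where
  "energy f = (\<Sum>i\<in>UNIV. \<Sum>j\<in>UNIV. A $ i $ j * (f $ i - f $ j)\<^sup>2) / 2"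

lemma weight_sym: "A $ i $ j = A $ j $ i"
  using graph unfolding weighted_graph_def transpose_def by (metis vec_lambda_beta)

lemma weight_nonneg: "0 \<le> A $ i $ j"
  using graph unfolding weighted_graph_def by blast

lemma sum_weight_left:
  "(\<Sum>i\<in>UNIV. \<Sum>j\<in>UNIV. A $ i $ j * h i) = (\<Sum>i\<in>UNIV. vertex_degree A i * h i)"
  by (simp add: vertex_degree_def sum_distrib_right)

lemma sum_weight_right:
  "(\<Sum>i\<in>UNIV. \<Sum>j\<in>UNIV. A $ i $ j * h j) = (\<Sum>i\<in>UNIV. vertex_degree A i * h i)"
  unfolding vertex_degree_def sum_distrib_right
  by (subst sum.swap) (intro sum.cong refl, simp add: weight_sym)

lemma ip_commute: "ip f g = ip g f"
  by (simp add: ip_def mult.commute)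

lemma ip_self_nonneg: "0 \<le> ip f f"
  unfolding ip_def by (intro sum_nonneg mult_nonneg_nonneg[OF less_imp_le[OF degree_pos]] zero_le_square)

lemma ip_diff_left: "ip (f - g) h = ip f h - ip g h"
  by (simp add: ip_def sum_subtractf algebra_simps)

lemma ip_diff_right: "ip h (f - g) = ip h f - ip h g"
  by (simp add: ip_def sum_subtractf algebra_simps)

section \<open>The lazy walk matrix as an operator\<close>

lemma matrix_inv_degree_matrix:
  "matrix_inv (degree_matrix A) = (\<chi> i j. if i = j then 1 / vertex_degree A i else 0)"
proof -
  define B :: "real^'n^'n" where "B = (\<chi> i j. if i = j then 1 / vertex_degree A i else 0)"
  have nz: "vertex_degree A i \<noteq> 0" for i using degree_pos[of i] by simp
  have "(\<Sum>k\<in>UNIV. degree_matrix A $ i $ k * B $ k $ j) =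
      (\<Sum>k\<in>UNIV. if k = i then if i = j then 1 else 0 else 0)"
    "(\<Sum>k\<in>UNIV. B $ i $ k * degree_matrix A $ k $ j) =
      (\<Sum>k\<in>UNIV. if k = i then if i = j then 1 else 0 else 0)" for i j
    by (rule sum.cong; auto simp: degree_matrix_def B_def nz)+
  then have B: "degree_matrix A ** B = mat 1 \<and> B ** degree_matrix A = mat 1"
    by (simp add: matrix_matrix_mult_def mat_def vec_eq_iff)
  \<comment> \<open>\<open>matrix_inv\<close> is a choice among inverses: the existence of
    \<open>B\<close> makes it an inverse, and uniqueness then identifies it with
    \<open>B\<close>.\<close>
  then have "degree_matrix A ** matrix_inv (degree_matrix A) = mat 1"
    unfolding matrix_inv_def by (rule someI2) simp
  with B have "matrix_inv (degree_matrix A) = B"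
    by (metis matrix_mul_assoc matrix_mul_lid matrix_mul_rid)
  then show ?thesis by (simp only: B_def)
qed

lemma lazy_walk_nth:
  "lazy_walk A $ i $ j = ((if i = j then 1 else 0) + A $ i $ j / vertex_degree A i) / 2"
  by (simp add: lazy_walk_def matrix_inv_degree_matrix matrix_matrix_mult_def mat_def
      if_distrib if_distribR sum.delta cong: if_cong)

lemma lazy_walk_mult_nth:
  "(lazy_walk A *v f) $ i = (f $ i + (\<Sum>j\<in>UNIV. A $ i $ j * f $ j) / vertex_degree A i) / 2"
proof -
  have "(lazy_walk A *v f) $ i =
      (\<Sum>j\<in>UNIV. (if i = j then f $ j else 0) / 2 + A $ i $ j * f $ j / vertex_degree A i / 2)"
    unfolding matrix_vector_mult_def lazy_walk_nth
    by (simp, rule sum.cong) (auto simp: field_simps)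
  also have "\<dots> = f $ i / 2 + (\<Sum>j\<in>UNIV. A $ i $ j * f $ j) / vertex_degree A i / 2"
    by (simp add: sum.distrib flip: sum_divide_distrib)
  finally show ?thesis by (simp add: add_divide_distrib)
qed

text \<open>The degree weights cancel the division by the degree in \<open>lazy_walk\<close>,
  leaving the bilinear form of the symmetric matrix \<open>A\<close>; self-adjointness follows from
  this.\<close>

lemma ip_lazy_walk:
  "ip f (lazy_walk A *v g) = (ip f g + (\<Sum>i\<in>UNIV. \<Sum>j\<in>UNIV. A $ i $ j * (f $ i * g $ j))) / 2"
proof -
  have "ip f (lazy_walk A *v g) = (\<Sum>i\<in>UNIV. (vertex_degree A i * (f $ i * g $ i)
      + (\<Sum>j\<in>UNIV. A $ i $ j * (f $ i * g $ j))) / 2)"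
    unfolding ip_def lazy_walk_mult_nth
  proof (rule sum.cong)
    fix i
    have "vertex_degree A i \<noteq> 0" using degree_pos[of i] by simp
    moreover have "(\<Sum>j\<in>UNIV. A $ i $ j * (f $ i * g $ j)) = f $ i * (\<Sum>j\<in>UNIV. A $ i $ j * g $ j)"
      by (simp add: sum_distrib_left algebra_simps)
    ultimately show "vertex_degree A i * (f $ i * ((g $ i + (\<Sum>j\<in>UNIV. A $ i $ j * g $ j) /
        vertex_degree A i) / 2)) = (vertex_degree A i * (f $ i * g $ i)
      + (\<Sum>j\<in>UNIV. A $ i $ j * (f $ i * g $ j))) / 2"
      by (simp add: field_simps)
  qed simp
  then show ?thesis by (simp add: ip_def sum.distrib flip: sum_divide_distrib)
qed

lemma ip_lazy_walk_adjoint: "ip f (lazy_walk A *v g) = ip (lazy_walk A *v f) g"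
proof -
  have "(\<Sum>i\<in>UNIV. \<Sum>j\<in>UNIV. A $ i $ j * (f $ i * g $ j)) =
      (\<Sum>i\<in>UNIV. \<Sum>j\<in>UNIV. A $ i $ j * (g $ i * f $ j))"
    by (subst sum.swap) (intro sum.cong refl, simp add: weight_sym mult.commute)
  then show ?thesis by (simp add: ip_commute[of _ g] ip_lazy_walk)
qed

lemma sum_weight_square_diff:
  "(\<Sum>i\<in>UNIV. \<Sum>j\<in>UNIV. A $ i $ j * (f $ i - f $ j)\<^sup>2) =
    2 * ip f f - 2 * (\<Sum>i\<in>UNIV. \<Sum>j\<in>UNIV. A $ i $ j * (f $ i * f $ j))"
proof -
  have "(\<Sum>i\<in>UNIV. \<Sum>j\<in>UNIV. A $ i $ j * (f $ i - f $ j)\<^sup>2) =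
    (\<Sum>i\<in>UNIV. \<Sum>j\<in>UNIV. A $ i $ j * (f $ i * f $ i)) +
    (\<Sum>i\<in>UNIV. \<Sum>j\<in>UNIV. A $ i $ j * (f $ j * f $ j)) -
    2 * (\<Sum>i\<in>UNIV. \<Sum>j\<in>UNIV. A $ i $ j * (f $ i * f $ j))"
    unfolding sum_distrib_left sum.distrib[symmetric] sum_subtractf[symmetric]
    by (intro sum.cong refl) (simp add: power2_eq_square algebra_simps)
  also have "\<dots> = 2 * ip f f - 2 * (\<Sum>i\<in>UNIV. \<Sum>j\<in>UNIV. A $ i $ j * (f $ i * f $ j))"
    unfolding ip_def sum_weight_right[of "\<lambda>i. f $ i * f $ i"]
      sum_weight_left[of "\<lambda>i. f $ i * f $ i"] by simp
  finally show ?thesis .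
qed

lemma sum_weight_square_add:
  "(\<Sum>i\<in>UNIV. \<Sum>j\<in>UNIV. A $ i $ j * (f $ i + f $ j)\<^sup>2) =
    2 * ip f f + 2 * (\<Sum>i\<in>UNIV. \<Sum>j\<in>UNIV. A $ i $ j * (f $ i * f $ j))"
proof -
  have "(\<Sum>i\<in>UNIV. \<Sum>j\<in>UNIV. A $ i $ j * (f $ i + f $ j)\<^sup>2) =
    (\<Sum>i\<in>UNIV. \<Sum>j\<in>UNIV. A $ i $ j * (f $ i * f $ i)) +
    (\<Sum>i\<in>UNIV. \<Sum>j\<in>UNIV. A $ i $ j * (f $ j * f $ j)) +
    2 * (\<Sum>i\<in>UNIV. \<Sum>j\<in>UNIV. A $ i $ j * (f $ i * f $ j))"
    unfolding sum_distrib_left sum.distrib[symmetric]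
    by (intro sum.cong refl) (simp add: power2_eq_square algebra_simps)
  also have "\<dots> = 2 * ip f f + 2 * (\<Sum>i\<in>UNIV. \<Sum>j\<in>UNIV. A $ i $ j * (f $ i * f $ j))"
    unfolding ip_def sum_weight_right[of "\<lambda>i. f $ i * f $ i"]
      sum_weight_left[of "\<lambda>i. f $ i * f $ i"] by simp
  finally show ?thesis .
qed

lemma energy_nonneg: "0 \<le> energy f"
  unfolding energy_def
  by (intro divide_nonneg_nonneg sum_nonneg mult_nonneg_nonneg weight_nonneg) auto

text \<open>Laziness makes \<open>I - M\<close> half of the normalized Laplacian, so one step costs
  only half of the energy.\<close>

lemma ip_lazy_walk_self: "ip f (lazy_walk A *v f) = ip f f - energy f / 2"
  unfolding ip_lazy_walk energy_def sum_weight_square_diff by (simp add: field_simps)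

lemma ip_lazy_walk_self_le: "ip f (lazy_walk A *v f) \<le> ip f f"
  using energy_nonneg[of f] by (simp add: ip_lazy_walk_self)

text \<open>
  The value of \<open>M f\<close> at \<open>i\<close> is the average of \<open>(f\<^sub>i + f\<^sub>j) / 2\<close> with weights \<open>A\<^sub>i\<^sub>j / d(i)\<close>, so
  Jensen's inequality applies at each vertex.
\<close>

lemma ip_lazy_walk_square_le:
  "ip (lazy_walk A *v f) (lazy_walk A *v f) \<le> ip f (lazy_walk A *v f)"
proof -
  let ?m = "lazy_walk A *v f"
  have *: "vertex_degree A i * (?m $ i * ?m $ i) \<le> (\<Sum>j\<in>UNIV. A $ i $ j * (f $ i + f $ j)\<^sup>2) / 4"
    for i
  proof -
    have mean: "(\<Sum>j\<in>UNIV. A $ i $ j * (f $ i + f $ j)) = 2 * vertex_degree A i * ?m $ i"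
    proof -
      have "(\<Sum>j\<in>UNIV. A $ i $ j * (f $ i + f $ j)) =
          vertex_degree A i * f $ i + (\<Sum>j\<in>UNIV. A $ i $ j * f $ j)"
        by (simp add: vertex_degree_def sum_distrib_right distrib_left sum.distrib)
      then show ?thesis
        using degree_pos[of i] by (simp add: lazy_walk_mult_nth field_simps)
    qed
    have "0 \<le> (\<Sum>j\<in>UNIV. A $ i $ j * ((f $ i + f $ j) / 2 - ?m $ i)\<^sup>2)"
      by (intro sum_nonneg mult_nonneg_nonneg weight_nonneg) auto
    also have "\<dots> = (\<Sum>j\<in>UNIV. A $ i $ j * (f $ i + f $ j)\<^sup>2) / 4
        - ?m $ i * (\<Sum>j\<in>UNIV. A $ i $ j * (f $ i + f $ j)) + vertex_degree A i * (?m $ i * ?m $ i)"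
      unfolding vertex_degree_def sum_distrib_left sum_distrib_right sum_divide_distrib
        sum_subtractf[symmetric] sum.distrib[symmetric]
      by (rule sum.cong) (auto simp: power2_eq_square field_simps)
    finally show ?thesis unfolding mean by (simp add: algebra_simps)
  qed
  have "ip ?m ?m \<le> (\<Sum>i\<in>UNIV. (\<Sum>j\<in>UNIV. A $ i $ j * (f $ i + f $ j)\<^sup>2) / 4)"
    unfolding ip_def by (intro sum_mono *)
  also have "\<dots> = ip f ?m"
    by (simp add: sum_weight_square_add ip_lazy_walk field_simps flip: sum_divide_distrib)
  finally show ?thesis .
qed

text \<open>Laziness rules out negative eigenvalues. This positivity gives convexity of the return
  sequence at odd times.\<close>

lemma ip_lazy_walk_self_nonneg: "0 \<le> ip f (lazy_walk A *v f)"
  using ip_lazy_walk_square_le ip_self_nonneg order_trans by blast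

section \<open>Cuts, the coarea inequality and Cheeger's inequality on a support\<close>

lemma vol_pos: "S \<noteq> {} \<Longrightarrow> 0 < vol A S"
  unfolding vol_def by (intro sum_pos degree_pos) auto

lemma cut_weight_nonneg: "0 \<le> cut_weight A S"
  unfolding cut_weight_def by (intro sum_nonneg weight_nonneg)

lemma cut_weight_le_vol: "cut_weight A S \<le> vol A S"
  unfolding cut_weight_def vol_def vertex_degree_def
  by (intro sum_mono sum_mono2 weight_nonneg) auto

text \<open>Each crossing edge is counted once from either side. This evaluates a single layer of
  the coarea decomposition.\<close>

lemma sum_weight_indicator_diff:
  "(\<Sum>i\<in>UNIV. \<Sum>j\<in>UNIV. A $ i $ j * \<bar>indicator T i - indicator T j\<bar>) = 2 * cut_weight A T"
proof -
  have "(\<Sum>i\<in>UNIV. \<Sum>j\<in>UNIV. A $ i $ j * \<bar>indicator T i - indicator T j\<bar>) =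
      (\<Sum>i\<in>UNIV. \<Sum>j\<in>UNIV. A $ i $ j * (indicator T i * indicator (-T) j)) +
      (\<Sum>i\<in>UNIV. \<Sum>j\<in>UNIV. A $ i $ j * (indicator T j * indicator (-T) i))"
    unfolding sum.distrib[symmetric]
    by (intro sum.cong refl) (auto simp: indicator_def)
  also have "(\<Sum>i\<in>UNIV. \<Sum>j\<in>UNIV. A $ i $ j * (indicator T j * indicator (-T) i)) =
      (\<Sum>i\<in>UNIV. \<Sum>j\<in>UNIV. A $ i $ j * (indicator T i * indicator (-T) j))"
    by (subst sum.swap) (simp add: weight_sym)
  also have "(\<Sum>i\<in>UNIV. \<Sum>j\<in>UNIV. A $ i $ j * (indicator T i * indicator (-T) j)) = cut_weight A T"
  proof -
    have "(\<Sum>j\<in>UNIV. A $ i $ j * (indicator T i * indicator (-T) j)) =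
        (\<Sum>j\<in>-T. A $ i $ j) * indicator T i" for i
      unfolding sum_eq_sum_indicator[of _ "-T"] sum_distrib_right
      by (rule sum.cong) (auto simp: indicator_def)
    then show ?thesis
      unfolding cut_weight_def sum_eq_sum_indicator[of _ T] by simp
  qed
  finally show ?thesis by simp
qed

lemma vol_eq_sum_indicator: "vol A T = (\<Sum>i\<in>UNIV. vertex_degree A i * indicator T i)"
  unfolding vol_def by (rule sum_eq_sum_indicator)

text \<open>A discrete coarea inequality: peel off the lowest level set of \<open>h\<close>.\<close>

lemma sum_weight_abs_diff_ge:
  fixes h :: "'n \<Rightarrow> real"
  assumes "\<And>i. 0 \<le> h i"
    and "\<And>T. T \<noteq> {} \<Longrightarrow> T \<subseteq> {i. 0 < h i} \<Longrightarrow> \<phi> * vol A T \<le> cut_weight A T"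
  shows "2 * \<phi> * (\<Sum>i\<in>UNIV. vertex_degree A i * h i)
    \<le> (\<Sum>i\<in>UNIV. \<Sum>j\<in>UNIV. A $ i $ j * \<bar>h i - h j\<bar>)"
  using assms
proof (induction "card {i. 0 < h i}" arbitrary: h rule: less_induct)
  case (less h)
  let ?T = "{i. 0 < h i}"
  show ?case
  proof (cases "?T = {}")
    case True
    then have "h i = 0" for i using less.prems(1)[of i] by (auto intro: antisym simp: not_less)
    then show ?thesis by simp
  next
    case False
    \<comment> \<open>Lowering the support by its least value removes at least the minimizing
      vertices, so the induction on the size of the support applies to \<open>k\<close>.\<close>
    define m where "m = Min (h ` ?T)"
    define k where "k i = h i - m * indicator ?T i" for i
    have m_in: "m \<in> h ` ?T" unfolding m_def using False by (intro Min_in) auto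
    then have m_pos: "0 < m" by auto
    have m_le: "m \<le> h i" if "0 < h i" for i unfolding m_def using that by (intro Min_le) auto
    have outside: "h i = 0" if "\<not> 0 < h i" for i using less.prems(1)[of i] that by simp
    have k_nonneg: "0 \<le> k i" for i
      using m_le[of i] outside[of i] by (auto simp: k_def indicator_def)
    have sub: "{i. 0 < k i} \<subseteq> ?T"
      using m_pos by (auto simp: k_def indicator_def split: if_splits)
    obtain i0 where "i0 \<in> ?T" "h i0 = m" using m_in by auto
    then have "i0 \<in> ?T - {i. 0 < k i}" by (simp add: k_def)
    then have "{i. 0 < k i} \<subset> ?T" using sub by blast
    then have "card {i. 0 < k i} < card ?T" by (intro psubset_card_mono) auto
    then have IH: "2 * \<phi> * (\<Sum>i\<in>UNIV. vertex_degree A i * k i)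
        \<le> (\<Sum>i\<in>UNIV. \<Sum>j\<in>UNIV. A $ i $ j * \<bar>k i - k j\<bar>)"
      by (rule less.hyps) (use k_nonneg less.prems(2) sub in auto)
    \<comment> \<open>The two parts never cancel: within \<open>?T\<close> the indicators agree, and
      across its boundary \<open>k\<close> vanishes outside and is nonnegative inside.\<close>
    have abs_split: "\<bar>h i - h j\<bar> = \<bar>k i - k j\<bar> + m * \<bar>indicator ?T i - indicator ?T j\<bar>" for i j
      using m_le[of i] m_le[of j] outside[of i] outside[of j] m_pos
      by (cases "0 < h i"; cases "0 < h j") (auto simp: k_def indicator_def)
    have "(\<Sum>i\<in>UNIV. \<Sum>j\<in>UNIV. A $ i $ j * \<bar>h i - h j\<bar>) =
        (\<Sum>i\<in>UNIV. \<Sum>j\<in>UNIV. A $ i $ j * \<bar>k i - k j\<bar>) +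
        m * (\<Sum>i\<in>UNIV. \<Sum>j\<in>UNIV. A $ i $ j * \<bar>indicator ?T i - indicator ?T j\<bar>)"
      unfolding abs_split by (simp only: sum.distrib sum_distrib_left distrib_left mult.left_commute)
    also have "\<dots> = (\<Sum>i\<in>UNIV. \<Sum>j\<in>UNIV. A $ i $ j * \<bar>k i - k j\<bar>) + m * (2 * cut_weight A ?T)"
      by (simp only: sum_weight_indicator_diff)
    also have "\<dots> \<ge> 2 * \<phi> * (\<Sum>i\<in>UNIV. vertex_degree A i * k i) + m * (2 * (\<phi> * vol A ?T))"
      using IH less.prems(2)[OF False] m_pos by (intro add_mono mult_left_mono) auto
    also have "2 * \<phi> * (\<Sum>i\<in>UNIV. vertex_degree A i * k i) + m * (2 * (\<phi> * vol A ?T)) =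
        2 * \<phi> * (\<Sum>i\<in>UNIV. vertex_degree A i * h i)"
    proof -
      have "(\<Sum>i\<in>UNIV. vertex_degree A i * k i) =
          (\<Sum>i\<in>UNIV. vertex_degree A i * h i) - m * vol A ?T"
        unfolding vol_eq_sum_indicator sum_distrib_left sum_subtractf[symmetric]
        by (rule sum.cong) (auto simp: k_def algebra_simps)
      then show ?thesis by (simp only:) (simp add: algebra_simps)
    qed
    finally show ?thesis .
  qed
qed

text \<open>Apply the coarea inequality to the square of \<open>g\<close>, factor the difference of
  squares, and use Cauchy-Schwarz over ordered pairs of vertices. All level sets lie in the support,
  so expansion is required only there.\<close>

lemma cheeger_support:
  fixes g :: "real^'n"
  assumes "\<And>i. 0 \<le> g $ i" "0 \<le> \<phi>"
    and "\<And>T. T \<noteq> {} \<Longrightarrow> T \<subseteq> {i. 0 < g $ i} \<Longrightarrow> \<phi> * vol A T \<le> cut_weight A T"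
  shows "\<phi>\<^sup>2 / 2 * ip g g \<le> energy g"
proof (cases "ip g g = 0")
  case True
  then show ?thesis by (simp add: energy_nonneg)
next
  case False
  then have pos: "0 < ip g g" using ip_self_nonneg[of g] by linarith
  let ?a = "\<lambda>(i,j). sqrt (A $ i $ j) * \<bar>g $ i - g $ j\<bar>"
  let ?b = "\<lambda>(i,j). sqrt (A $ i $ j) * \<bar>g $ i + g $ j\<bar>"
  have supp: "{i. 0 < g $ i * g $ i} = {i. 0 < g $ i}"
    using assms(1) by (auto simp: zero_less_mult_iff not_less[symmetric])
  have "2 * \<phi> * (\<Sum>i\<in>UNIV. vertex_degree A i * (g $ i * g $ i))
      \<le> (\<Sum>i\<in>UNIV. \<Sum>j\<in>UNIV. A $ i $ j * \<bar>g $ i * g $ i - g $ j * g $ j\<bar>)"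
    by (rule sum_weight_abs_diff_ge) (use assms supp in auto)
  also have "\<dots> = (\<Sum>p\<in>UNIV. ?a p * ?b p)"
  proof -
    have "A $ i $ j * \<bar>g $ i * g $ i - g $ j * g $ j\<bar> = ?a (i,j) * ?b (i,j)" for i j
    proof -
      have "\<bar>g $ i * g $ i - g $ j * g $ j\<bar> = \<bar>g $ i - g $ j\<bar> * \<bar>g $ i + g $ j\<bar>"
        unfolding abs_mult[symmetric] by (simp add: algebra_simps)
      moreover have "A $ i $ j = sqrt (A $ i $ j) * sqrt (A $ i $ j)"
        using weight_nonneg by simp
      ultimately show ?thesis by (simp only: prod.case) (simp add: mult_ac weight_nonneg)
    qed
    then show ?thesis
      by (simp add: sum.cartesian_product UNIV_Times_UNIV[symmetric] del: UNIV_Times_UNIV)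
         (rule sum.cong, auto)
  qed
  finally have le: "2 * \<phi> * ip g g \<le> (\<Sum>p\<in>UNIV. ?a p * ?b p)" unfolding ip_def .
  have a2: "(\<Sum>p\<in>UNIV. (?a p)\<^sup>2) = 2 * energy g"
  proof -
    have "(\<Sum>p\<in>UNIV. (?a p)\<^sup>2) = (\<Sum>p\<in>UNIV. case p of (i,j) \<Rightarrow> A $ i $ j * (g $ i - g $ j)\<^sup>2)"
      by (rule sum.cong) (auto simp: power_mult_distrib weight_nonneg)
    then show ?thesis
      by (simp add: energy_def sum.cartesian_product UNIV_Times_UNIV[symmetric] del: UNIV_Times_UNIV)
  qed
  have b2: "(\<Sum>p\<in>UNIV. (?b p)\<^sup>2) = 4 * ip g g - 2 * energy g"
  proof -
    have "(\<Sum>p\<in>UNIV. (?b p)\<^sup>2) = (\<Sum>p\<in>UNIV. case p of (i,j) \<Rightarrow> A $ i $ j * (g $ i + g $ j)\<^sup>2)"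
      by (rule sum.cong) (auto simp: power_mult_distrib weight_nonneg)
    also have "\<dots> = (\<Sum>i\<in>UNIV. \<Sum>j\<in>UNIV. A $ i $ j * (g $ i + g $ j)\<^sup>2)"
      by (simp add: sum.cartesian_product UNIV_Times_UNIV[symmetric] del: UNIV_Times_UNIV)
    finally show ?thesis
      unfolding energy_def sum_weight_square_add sum_weight_square_diff by (simp add: field_simps)
  qed
  have "(2 * \<phi> * ip g g)\<^sup>2 \<le> (\<Sum>p\<in>UNIV. ?a p * ?b p)\<^sup>2"
    using le assms(2) pos by (intro power_mono) auto
  also have "\<dots> \<le> (2 * energy g) * (4 * ip g g - 2 * energy g)"
    using Cauchy_Schwarz_ineq_sum[of ?a ?b UNIV] by (simp only: a2 b2)
  \<comment> \<open>Dropping \<open>2 * energy g\<close> trades a quadratic bound for the linear one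
    with constant \<open>\<phi>\<^sup>2 / 2\<close>.\<close>
  also have "\<dots> \<le> (2 * energy g) * (4 * ip g g)"
    using energy_nonneg[of g] by (intro mult_left_mono) auto
  finally have "(\<phi>\<^sup>2 / 2 * ip g g) * (8 * ip g g) \<le> energy g * (8 * ip g g)"
    by (simp add: power2_eq_square algebra_simps)
  then show ?thesis by (rule mult_right_le_imp_le) (use pos in simp)
qed

text \<open>The support of \<open>f\<close> may be large, but its truncation \<open>g\<close> lives
  on small volume by Markov's inequality. Truncation is 1-Lipschitz, so it does not raise the
  energy, and keeping half of the squared norm turns the constant 1/2 of Cheeger's inequality into
  1/4.\<close>

lemma energy_ge_of_norm_ratio:
  fixes f :: "real^'n"
  assumes nonneg: "\<And>i. 0 \<le> f $ i" and "0 \<le> \<phi>"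
    and pos: "0 < ip f f"
    and ratio: "4 * (ip f 1)\<^sup>2 \<le> \<nu> * ip f f"
    and expand: "\<And>T. T \<noteq> {} \<Longrightarrow> vol A T \<le> \<nu> \<Longrightarrow> \<phi> * vol A T \<le> cut_weight A T"
  shows "\<phi>\<^sup>2 / 4 * ip f f \<le> energy f"
proof -
  have L_nonneg: "0 \<le> ip f 1"
    unfolding ip_def
    by (intro sum_nonneg mult_nonneg_nonneg less_imp_le[OF degree_pos]) (auto simp: nonneg)
  have "ip f 1 \<noteq> 0"
  proof
    assume "ip f 1 = 0"
    then have "vertex_degree A i * f $ i = 0" for i
      using nonneg degree_pos by (simp add: ip_def sum_nonneg_eq_0_iff less_imp_le)
    then have "f $ i = 0" for i using degree_pos[of i] by (metis less_irrefl mult_eq_0_iff)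
    then show False using pos by (simp add: ip_def)
  qed
  with L_nonneg have L_pos: "0 < ip f 1" by simp
  \<comment> \<open>The choice makes the loss \<open>2 * c * ip f 1\<close> exactly half of
    \<open>ip f f\<close>, while Markov's bound \<open>ip f 1 / c\<close> on the volume is at most
    \<nu> by \<open>ratio\<close>.\<close>
  define c where "c = ip f f / (4 * ip f 1)"
  have c_pos: "0 < c" using pos L_pos by (simp add: c_def)
  define g :: "real^'n" where "g = (\<chi> i. max (f $ i - c) 0)"
  have supp: "vol A {i. 0 < g $ i} \<le> \<nu>"
  proof -
    have "c * vol A {i. 0 < g $ i} \<le> ip f 1"
      unfolding vol_eq_sum_indicator ip_def sum_distrib_left
    proof (rule sum_mono)
      fix i
      have "vertex_degree A i * (c * indicator {i. 0 < g $ i} i) \<le> vertex_degree A i * f $ i"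
        using degree_pos[of i] nonneg[of i]
        by (intro mult_left_mono) (auto simp: g_def indicator_def less_imp_le)
      then show "c * (vertex_degree A i * indicator {i. 0 < g $ i} i)
          \<le> vertex_degree A i * (f $ i * 1 $ i)" by (simp add: algebra_simps)
    qed
    also have "ip f 1 \<le> c * \<nu>"
      using ratio L_pos by (simp add: c_def field_simps power2_eq_square)
    finally show ?thesis using c_pos by simp
  qed
  have "\<phi>\<^sup>2 / 2 * ip g g \<le> energy g"
  proof (rule cheeger_support)
    fix T assume T: "T \<noteq> {}" "T \<subseteq> {i. 0 < g $ i}"
    then have "vol A T \<le> vol A {i. 0 < g $ i}"
      unfolding vol_def by (intro sum_mono2) (auto intro: less_imp_le degree_pos)
    with supp T show "\<phi> * vol A T \<le> cut_weight A T" by (intro expand) auto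
  qed (auto simp: g_def assms)
  moreover have "energy g \<le> energy f"
    unfolding energy_def
  proof (intro divide_right_mono sum_mono mult_left_mono weight_nonneg)
    fix i j
    show "(g $ i - g $ j)\<^sup>2 \<le> (f $ i - f $ j)\<^sup>2"
      unfolding abs_le_square_iff[symmetric] by (auto simp: g_def)
  qed auto
  moreover have "ip f f / 2 \<le> ip g g"
  proof -
    have "ip f f / 2 = ip f f - 2 * c * ip f 1"
      using L_pos by (simp add: c_def field_simps)
    also have "\<dots> = (\<Sum>i\<in>UNIV. vertex_degree A i * (f $ i * f $ i - 2 * c * f $ i))"
      by (simp add: ip_def sum_distrib_left sum_subtractf algebra_simps)
    also have "\<dots> \<le> ip g g"
      unfolding ip_def
    proof (intro sum_mono mult_left_mono)
      fix i
      \<comment> \<open>Above the threshold the sides differ by the square of \<open>c\<close>;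
        below it the left side is nonpositive.\<close>
      show "f $ i * f $ i - 2 * c * f $ i \<le> g $ i * g $ i"
      proof (cases "f $ i \<le> c")
        case True
        then have "f $ i * f $ i \<le> 2 * c * f $ i"
          using nonneg[of i] c_pos by (intro mult_right_mono) auto
        then show ?thesis using True by (simp add: g_def max_def)
      next
        case False
        then show ?thesis by (simp add: g_def max_def algebra_simps)
      qed
    qed (auto intro: less_imp_le degree_pos)
    finally show ?thesis .
  qed
  then have "\<phi>\<^sup>2 / 2 * (ip f f / 2) \<le> \<phi>\<^sup>2 / 2 * ip g g" by (intro mult_left_mono) auto
  ultimately show ?thesis by (simp add: mult.commute)
qed

section \<open>The return sequence of a vertex set\<close>

definition walk_from :: "'n set \<Rightarrow> nat \<Rightarrow> real^'n" where
  "walk_from S t = matrix_power (lazy_walk A) t *v (\<chi> i. indicator S i)"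

text \<open>Divided by \<open>vol A S\<close>, this is the probability that the walk started at a
  vertex of \<open>S\<close>, drawn in proportion to degree, is in \<open>S\<close> at time
  \<open>t\<close>; it may leave in between.\<close>

definition walk_return :: "'n set \<Rightarrow> nat \<Rightarrow> real" where
  "walk_return S t = ip (walk_from S 0) (walk_from S t)"

lemma walk_from_0: "walk_from S 0 = (\<chi> i. indicator S i)"
  by (simp add: walk_from_def)

lemma walk_from_Suc: "walk_from S (Suc t) = lazy_walk A *v walk_from S t"
  by (simp add: walk_from_def matrix_vector_mul_assoc)

text \<open>Self-adjointness moves the steps across the inner product one at a time, so only the
  total number of steps matters.\<close>

lemma ip_walk_from: "ip (walk_from S s) (walk_from S t) = walk_return S (s + t)"
proof (induction s arbitrary: t)
  case 0
  then show ?case by (simp add: walk_return_def)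
next
  case (Suc s)
  then show ?case by (metis add_Suc_shift ip_lazy_walk_adjoint walk_from_Suc)
qed

lemma walk_return_even: "walk_return S (2 * s) = ip (walk_from S s) (walk_from S s)"
  by (simp add: ip_walk_from mult_2)

lemma walk_return_odd:
  "walk_return S (Suc (2 * s)) = ip (walk_from S s) (lazy_walk A *v walk_from S s)"
  by (simp add: ip_walk_from mult_2 flip: walk_from_Suc)

text \<open>Even times use \<open>M \<le> I\<close>, odd times \<open>M\<^sup>2 \<le> M\<close>,
  each applied to the walk at half the time.\<close>

lemma walk_return_Suc_le: "walk_return S (Suc t) \<le> walk_return S t"
proof (cases "even t")
  case True
  then obtain s where "t = 2 * s" by blast
  then show ?thesis by (simp add: walk_return_odd walk_return_even ip_lazy_walk_self_le)
next
  case False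
  then obtain s where t: "t = Suc (2 * s)" by (metis oddE Suc_eq_plus1)
  then have "walk_return S (Suc t) = walk_return S (2 * Suc s)" by simp
  then show ?thesis
    unfolding t by (simp only: walk_return_odd walk_return_even walk_from_Suc ip_lazy_walk_square_le)
qed

text \<open>The second difference pairs \<open>(I - M) \<chi>\<^sub>S\<close> with its image under
  \<open>M\<^sup>t\<close>. Splitting the power in halves leaves a squared norm for even
  \<open>t\<close>, and one factor \<open>M\<close>, which is positive semidefinite, for odd
  \<open>t\<close>.\<close>

lemma walk_return_convex: "2 * walk_return S (Suc t) \<le> walk_return S t + walk_return S (Suc (Suc t))"
proof -
  let ?D = "\<lambda>s. walk_from S s - walk_from S (Suc s)"
  have D: "ip (?D s) (?D r) = walk_return S (s + r) - 2 * walk_return S (Suc (s + r))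
      + walk_return S (Suc (Suc (s + r)))" for s r
    by (simp add: ip_diff_left ip_diff_right ip_walk_from)
  have "0 \<le> ip (?D (t div 2)) (?D (t - t div 2))"
  proof (cases "even t")
    case True
    then have "t - t div 2 = t div 2" by (elim evenE) simp
    then show ?thesis by (simp add: ip_self_nonneg)
  next
    case False
    then have "t - t div 2 = Suc (t div 2)" by (elim oddE) simp
    then have "?D (t - t div 2) = lazy_walk A *v ?D (t div 2)"
      by (simp add: walk_from_Suc matrix_vector_mult_diff_distrib)
    then show ?thesis by (simp only: ip_lazy_walk_self_nonneg)
  qed
  moreover have "t div 2 + (t - t div 2) = t" by simp
  ultimately show ?thesis unfolding D by simp
qed

text \<open>By convexity the first drop is the largest; the drops telescope.\<close>

lemma walk_return_drop_le:
  "walk_return S 0 - walk_return S t \<le> real t * (walk_return S 0 - walk_return S 1)"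
proof -
  have step: "walk_return S t - walk_return S (Suc t) \<le> walk_return S 0 - walk_return S 1" for t
  proof (induction t)
    case (Suc t)
    then show ?case using walk_return_convex[of S t] by simp
  qed simp
  show ?thesis
  proof (induction t)
    case (Suc t)
    then show ?case using step[of t] by (simp add: algebra_simps)
  qed simp
qed

lemma walk_return_0: "walk_return S 0 = vol A S"
  unfolding walk_return_def ip_def walk_from_0 vol_eq_sum_indicator
  by (rule sum.cong) (auto simp: indicator_def)

text \<open>The energy of an indicator is the cut weight. The lazy half here is the source of the
  factor \<open>t / 2\<close> in the upper bound.\<close>

lemma walk_return_1: "walk_return S 1 = vol A S - cut_weight A S / 2"
proof -
  have "walk_return S 1 = ip (walk_from S 0) (walk_from S 0) - energy (walk_from S 0) / 2"
    using walk_return_odd[of S 0] by (simp add: ip_lazy_walk_self)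
  moreover have "energy (walk_from S 0) = cut_weight A S"
  proof -
    have "(indicator S i - indicator S j)\<^sup>2 = \<bar>indicator S i - indicator S j :: real\<bar>" for i j
      by (auto simp: indicator_def)
    then show ?thesis
      by (simp add: energy_def walk_from_0 sum_weight_indicator_diff)
  qed
  ultimately show ?thesis by (simp add: walk_return_0 flip: walk_return_def)
qed

lemma lazy_walk_mult_1: "lazy_walk A *v 1 = 1"
proof -
  have "(lazy_walk A *v 1) $ i = 1" for i
    using degree_pos[of i] by (simp add: lazy_walk_mult_nth flip: vertex_degree_def)
  then show ?thesis by (simp add: vec_eq_iff)
qed

lemma matrix_power_lazy_walk_mult_1: "matrix_power (lazy_walk A) t *v 1 = 1"
  by (induction t) (simp_all add: lazy_walk_mult_1 flip: matrix_vector_mul_assoc)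

lemma walk_from_nonneg: "0 \<le> walk_from S t $ i"
proof (induction t arbitrary: i)
  case 0
  then show ?case by (simp add: walk_from_0)
next
  case (Suc t)
  then show ?case
    unfolding walk_from_Suc lazy_walk_mult_nth using degree_pos[of i]
    by (intro divide_nonneg_nonneg add_nonneg_nonneg sum_nonneg mult_nonneg_nonneg weight_nonneg) auto
qed

text \<open>Conservation of mass: \<open>M\<close> is self-adjoint and fixes the constant vector.
  Since the vectors are nonnegative, this is their 1-norm.\<close>

lemma ip_walk_from_1: "ip (walk_from S t) 1 = vol A S"
proof (induction t)
  case 0
  then show ?case by (simp add: ip_def walk_from_0 vol_eq_sum_indicator)
next
  case (Suc t)
  then show ?case by (simp add: walk_from_Suc lazy_walk_mult_1 flip: ip_lazy_walk_adjoint)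
qed

section \<open>Volumes and cuts in the graph of the walk\<close>

lemma walk_graph_nth:
  "walk_graph A t $ i $ j = vertex_degree A i * matrix_power (lazy_walk A) t $ i $ j"
  by (simp add: walk_graph_def degree_matrix_def matrix_matrix_mult_def if_distribR sum.delta
      if_distrib cong: if_cong)

text \<open>Powers of \<open>M\<close> have row sums 1. Hence volumes agree in both graphs, and both
  profiles range over the same sets.\<close>

lemma vertex_degree_walk_graph: "vertex_degree (walk_graph A t) i = vertex_degree A i"
proof -
  have "(matrix_power (lazy_walk A) t *v 1) $ i = 1"
    by (simp add: matrix_power_lazy_walk_mult_1)
  then have "(\<Sum>j\<in>UNIV. matrix_power (lazy_walk A) t $ i $ j) = 1"
    by (simp add: matrix_vector_mult_def)
  then show ?thesis
    by (simp add: vertex_degree_def[of "walk_graph A t"] walk_graph_nth flip: sum_distrib_left)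
qed

lemma vol_walk_graph: "vol (walk_graph A t) S = vol A S"
  by (simp add: vol_def vertex_degree_walk_graph)

text \<open>\<open>walk_return S t\<close> is the weight that the walk graph places inside
  \<open>S\<close>; the rest of the volume crosses the cut.\<close>

lemma cut_weight_walk_graph: "cut_weight (walk_graph A t) S = vol A S - walk_return S t"
proof -
  let ?W = "walk_graph A t"
  have split: "(\<Sum>j\<in>-S. ?W $ i $ j) = vertex_degree A i - (\<Sum>j\<in>S. ?W $ i $ j)" for i
  proof -
    have "(\<Sum>j\<in>UNIV. ?W $ i $ j) = (\<Sum>j\<in>-S. ?W $ i $ j) + (\<Sum>j\<in>S. ?W $ i $ j)"
      by (subst sum.union_disjoint[symmetric]) auto
    then show ?thesis using vertex_degree_walk_graph[of t i] unfolding vertex_degree_def[of ?W] by simp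
  qed
  have "walk_from S t $ i = (\<Sum>j\<in>S. matrix_power (lazy_walk A) t $ i $ j)" for i
    by (simp add: walk_from_def matrix_vector_mult_def indicator_def if_distrib sum.If_cases
        cong: if_cong)
  then have "vertex_degree A i * walk_from S t $ i = (\<Sum>j\<in>S. ?W $ i $ j)" for i
    by (simp add: walk_graph_nth sum_distrib_left)
  moreover have "walk_return S t = (\<Sum>i\<in>S. vertex_degree A i * walk_from S t $ i)"
    unfolding walk_return_def ip_def walk_from_0 sum_eq_sum_indicator[of _ S]
    by (simp add: mult_ac)
  ultimately show ?thesis
    by (simp add: cut_weight_def split sum_subtractf vol_def)
qed

lemma expansion_walk_graph:
  "S \<noteq> {} \<Longrightarrow> expansion (walk_graph A t) S = 1 - walk_return S t / vol A S"
  using vol_pos[of S] by (simp add: expansion_def cut_weight_walk_graph vol_walk_graph diff_divide_distrib)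

lemma expansion_walk_graph_le:
  assumes "S \<noteq> {}"
  shows "expansion (walk_graph A t) S \<le> real t / 2 * expansion A S"
proof -
  have "vol A S - walk_return S t \<le> real t / 2 * cut_weight A S"
    using walk_return_drop_le[of S t] by (simp add: walk_return_0 walk_return_1[simplified])
  then have "(vol A S - walk_return S t) / vol A S \<le> real t / 2 * cut_weight A S / vol A S"
    using vol_pos[OF assms] by (intro divide_right_mono) auto
  then show ?thesis
    by (simp add: expansion_def cut_weight_walk_graph vol_walk_graph)
qed

section \<open>Geometric decay of the return sequence\<close>

lemma walk_return_odd_le:
  assumes "S \<noteq> {}" "vol A S \<le> \<delta>" "0 < \<eta>" "0 \<le> \<phi>"
    and expand: "\<And>T. T \<noteq> {} \<Longrightarrow> vol A T \<le> 4 * \<delta> / \<eta> \<Longrightarrow> \<phi> * vol A T \<le> cut_weight A T"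
    and large: "\<eta> * vol A S < walk_return S (2 * s)"
  shows "walk_return S (Suc (2 * s)) \<le> (1 - \<phi>\<^sup>2 / 32)\<^sup>2 * walk_return S (2 * s)"
proof -
  let ?f = "walk_from S s"
  have V: "0 < vol A S" using assms(1) by (rule vol_pos)
  have pos: "0 < ip ?f ?f"
    using large V assms(3) unfolding walk_return_even
    by (meson less_trans mult_pos_pos)
  \<comment> \<open>One factor of the volume is bounded by \<delta>, the other, scaled by \<eta>, by
    the squared norm; this produces the scale \<open>4 * \<delta> / \<eta>\<close>.\<close>
  have "4 * (ip ?f 1)\<^sup>2 = 4 / \<eta> * vol A S * (\<eta> * vol A S)"
    using assms(3) by (simp add: ip_walk_from_1 power2_eq_square)
  also have "\<dots> \<le> 4 / \<eta> * \<delta> * ip ?f ?f"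
    using large V assms(2,3) unfolding walk_return_even
    by (intro mult_mono mult_left_mono) auto
  finally have "4 * (ip ?f 1)\<^sup>2 \<le> 4 * \<delta> / \<eta> * ip ?f ?f" by simp
  then have "\<phi>\<^sup>2 / 4 * ip ?f ?f \<le> energy ?f"
    using assms(4) pos by (intro energy_ge_of_norm_ratio walk_from_nonneg expand)
  \<comment> \<open>A step loses half of the energy, so 1/4 becomes 1/8.\<close>
  then have "walk_return S (Suc (2 * s)) \<le> (1 - \<phi>\<^sup>2 / 8) * walk_return S (2 * s)"
    unfolding walk_return_odd walk_return_even ip_lazy_walk_self by (simp add: left_diff_distrib)
  also have "1 - \<phi>\<^sup>2 / 8 \<le> (1 - \<phi>\<^sup>2 / 32)\<^sup>2"
  proof -
    have "(1 - \<phi>\<^sup>2 / 32)\<^sup>2 = 1 - \<phi>\<^sup>2 / 16 + (\<phi>\<^sup>2 / 32)\<^sup>2"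
      by (simp add: power2_eq_square[of "1 - _"] power2_eq_square[of "_ / 32"] algebra_simps)
    then show ?thesis using zero_le_power2[of \<phi>] zero_le_power2[of "\<phi>\<^sup>2 / 32"] by linarith
  qed
  finally show ?thesis
    using pos by (simp add: walk_return_even mult_right_mono)
qed

text \<open>Largeness is assumed only at time \<open>t\<close>; monotonicity carries it back to all
  earlier times, where the decay step needs it.\<close>

lemma walk_return_le:
  assumes "S \<noteq> {}" "vol A S \<le> \<delta>" "0 < \<eta>" "0 \<le> \<phi>" "\<phi> \<le> 1"
    and expand: "\<And>T. T \<noteq> {} \<Longrightarrow> vol A T \<le> 4 * \<delta> / \<eta> \<Longrightarrow> \<phi> * vol A T \<le> cut_weight A T"
    and large: "\<eta> * vol A S < walk_return S t"
  shows "walk_return S t \<le> (1 - \<phi>\<^sup>2 / 32) ^ t * vol A S"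
proof -
  let ?q = "1 - \<phi>\<^sup>2 / 32"
  have "\<phi>\<^sup>2 \<le> 1" using assms(4,5) by (simp add: power_le_one)
  then have q: "0 \<le> ?q" "?q \<le> 1" by auto
  have V: "0 < vol A S" using assms(1) by (rule vol_pos)
  \<comment> \<open>The exponent at time \<open>2 * s + 1\<close> is already that of time
    \<open>2 * s + 2\<close>, so the next step needs only monotonicity.\<close>
  have odd: "walk_return S (Suc (2 * s)) \<le> ?q ^ (2 * Suc s) * vol A S"
    if "walk_return S (2 * s) \<le> ?q ^ (2 * s) * vol A S" "\<eta> * vol A S < walk_return S (2 * s)" for s
  proof -
    have "walk_return S (Suc (2 * s)) \<le> ?q\<^sup>2 * walk_return S (2 * s)"
      by (rule walk_return_odd_le) (use assms that in auto)
    also have "\<dots> \<le> ?q\<^sup>2 * (?q ^ (2 * s) * vol A S)" using that by (intro mult_left_mono) auto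
    finally show ?thesis by (simp add: power2_eq_square mult_ac)
  qed
  have even: "walk_return S (2 * s) \<le> ?q ^ (2 * s) * vol A S"
    if "\<eta> * vol A S < walk_return S (2 * s)" for s
    using that
  proof (induction s)
    case 0
    then show ?case by (simp add: walk_return_0)
  next
    case (Suc s)
    have le1: "walk_return S (2 * Suc s) \<le> walk_return S (Suc (2 * s))"
      using walk_return_Suc_le[of S "Suc (2 * s)"] by simp
    then have "\<eta> * vol A S < walk_return S (2 * s)"
      using Suc.prems walk_return_Suc_le[of S "2 * s"] by linarith
    then show ?case using odd[of s] Suc.IH le1 by linarith
  qed
  show ?thesis
  proof (cases "even t")
    case True
    then obtain s where "t = 2 * s" by blast
    then show ?thesis using even large by simp
  next
    case False
    then obtain s where t: "t = Suc (2 * s)" by (metis oddE Suc_eq_plus1)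
    have "\<eta> * vol A S < walk_return S (2 * s)"
      using large walk_return_Suc_le[of S "2 * s"] unfolding t by linarith
    then have "walk_return S t \<le> ?q ^ (2 * Suc s) * vol A S"
      using odd even unfolding t by blast
    \<comment> \<open>For odd \<open>t\<close> the exponent is one too high; the surplus factor is
      at most 1.\<close>
    also have "\<dots> \<le> ?q ^ t * vol A S"
      using q V unfolding t by (intro mult_right_mono power_decreasing) auto
    finally show ?thesis .
  qed
qed

end

section \<open>The expansion profile as a minimum, and the two bounds\<close>

lemma expansion_profile_le:
  fixes A :: "real^'n^'n::finite"
  assumes "S \<noteq> {}" "vol A S \<le> \<delta>"
  shows "expansion_profile A \<delta> \<le> expansion A S"
  unfolding expansion_profile_def using assms by (intro Min_le) auto

lemma expansion_profile_attained:
  fixes A :: "real^'n^'n::finite"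
  assumes "\<exists>S. S \<noteq> {} \<and> vol A S \<le> \<delta>"
  obtains S where "S \<noteq> {}" "vol A S \<le> \<delta>" "expansion_profile A \<delta> = expansion A S"
proof -
  have "expansion_profile A \<delta> \<in> expansion A ` {S. S \<noteq> {} \<and> vol A S \<le> \<delta>}"
    unfolding expansion_profile_def using assms by (intro Min_in) auto
  then show ?thesis using that by blast
qed

theorem theorem3p1:
  fixes A :: "real^'n^'n::finite" and t :: nat and \<eta> \<delta> :: real
  assumes "weighted_graph A"
    and "\<And>i. 0 < vertex_degree A i"
    and "(\<Sum>i\<in>UNIV. vertex_degree A i) = 1"
    and "0 < \<eta>" "\<eta> \<le> 1"
    and "0 < \<delta>" "\<delta> \<le> 1"
    and "\<exists>S. S \<noteq> {} \<and> vol A S \<le> \<delta>"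
  shows "min (1 - (1 - (expansion_profile A (4 * \<delta> / \<eta>))\<^sup>2 / 32) ^ t) (1 - \<eta>)
           \<le> expansion_profile (walk_graph A t) \<delta>
       \<and> expansion_profile (walk_graph A t) \<delta> \<le> real t / 2 * expansion_profile A \<delta>"
proof
  interpret positive_weighted_graph A using assms(1,2) by unfold_locales
  let ?W = "walk_graph A t" and ?\<phi> = "expansion_profile A (4 * \<delta> / \<eta>)"
  obtain S where S: "S \<noteq> {}" "vol A S \<le> \<delta>" "expansion_profile A \<delta> = expansion A S"
    using assms(8) by (rule expansion_profile_attained)
  have "expansion_profile ?W \<delta> \<le> expansion ?W S"
    using S by (intro expansion_profile_le) (auto simp: vol_walk_graph)
  also have "\<dots> \<le> real t / 2 * expansion A S" using S(1) by (rule expansion_walk_graph_le)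
  finally show "expansion_profile ?W \<delta> \<le> real t / 2 * expansion_profile A \<delta>" using S(3) by simp

  \<comment> \<open>A set admissible at \<delta> stays admissible at the larger scale
    \<open>4 * \<delta> / \<eta>\<close>, so the profile there is a genuine minimum.\<close>
  have "\<delta> * \<eta> \<le> \<delta> * 4" using assms(5,6) by (intro mult_left_mono) auto
  then have "\<delta> \<le> 4 * \<delta> / \<eta>" using assms(4) by (simp add: field_simps)
  then have "\<exists>S. S \<noteq> {} \<and> vol A S \<le> 4 * \<delta> / \<eta>" using S by (meson order_trans)
  then obtain R where R: "R \<noteq> {}" "?\<phi> = expansion A R" by (rule expansion_profile_attained)
  have \<phi>: "0 \<le> ?\<phi>" "?\<phi> \<le> 1"
    using vol_pos[OF R(1)] cut_weight_nonneg[of R] cut_weight_le_vol[of R]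
    by (auto simp: R(2) expansion_def)
  have expand: "?\<phi> * vol A T \<le> cut_weight A T" if "T \<noteq> {}" "vol A T \<le> 4 * \<delta> / \<eta>" for T
    using expansion_profile_le[OF that] vol_pos[OF that(1)] by (simp add: expansion_def pos_le_divide_eq)
  have "\<exists>S. S \<noteq> {} \<and> vol ?W S \<le> \<delta>" using assms(8) by (simp add: vol_walk_graph)
  then obtain U where U: "U \<noteq> {}" "vol A U \<le> \<delta>" "expansion_profile ?W \<delta> = expansion ?W U"
    by (rule expansion_profile_attained) (auto simp: vol_walk_graph)
  have V: "0 < vol A U" using U(1) by (rule vol_pos)
  have eq: "expansion_profile ?W \<delta> = 1 - walk_return U t / vol A U"
    using U(1,3) by (simp add: expansion_walk_graph)
  \<comment> \<open>For the minimizing set \<open>U\<close>, a return probability above \<eta>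
    triggers the decay bound and gives the first term; otherwise the second term is
    immediate.\<close>
  show "min (1 - (1 - ?\<phi>\<^sup>2 / 32) ^ t) (1 - \<eta>) \<le> expansion_profile ?W \<delta>"
  proof (cases "\<eta> * vol A U < walk_return U t")
    case True
    then have "walk_return U t \<le> (1 - ?\<phi>\<^sup>2 / 32) ^ t * vol A U"
      using U assms(4) \<phi> expand by (intro walk_return_le)
    then have "walk_return U t / vol A U \<le> (1 - ?\<phi>\<^sup>2 / 32) ^ t"
      using V by (simp add: pos_divide_le_eq)
    then show ?thesis unfolding eq by linarith
  next
    case False
    then have "walk_return U t / vol A U \<le> \<eta>" using V by (simp add: pos_divide_le_eq)
    then show ?thesis unfolding eq by linarith
  qed
qed

end
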